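(* Let $n$ be a positive integer and let $\lambda=(1^{m_1}2^{m_2}\cdots)$ be a partition of $n$ (with $m_i$ parts of size $i$ for each $i\ge 1$). Let $\mathfrak{S}_n(\lambda)$ be the set of permutations in $\mathfrak{S}_n$ of cycle type $\lambda$, and let $z_\lambda=\prod_{i\ge1} i^{m_i}m_i!$. Then $$\sum_{\pi\in\mathfrak{S}_n(\lambda)} t^{\mathrm{cval}(\pi)}=\frac{n!}{z_\lambda}\left(1+\sqrt{1-t}\right)^{n-m_1}\prod_{i\ge1}\left[\frac{A_{i-1}(w)}{(i-1)!}\right]^{m_i},$$ where $w=2t^{-1}(1-\sqrt{1-t})-1$.
   Context: $[n]=\{1,\dots,n\}$ and $\mathfrak{S}_n$ is the symmetric group on $[n]$. For $\pi\in\mathfrak{S}_n$, a cyclic valley of $\pi$ is an $i\in[n]$ with $\pi^{-1}(i)>i<\pi(i)$, and $\mathrm{cval}(\pi)$ is the number of cyclic valleys. An excedance of $\pi$ is an $i\in[n]$ with $i<\pi(i)$, and $\mathrm{exc}(\pi)$ is the number of excedances. The Eulerian polynomials are $A_0(t)=1$ and, for $n\ge1$, $A_n(t)=\sum_{\pi\in\mathfrak{S}_n}t^{\mathrm{des}(\pi)+1}=\sum_{\pi\in\mathfrak{S}_n}t^{\mathrm{exc}(\pi)+1}$, where $\mathrm{des}(\pi)$ is the number of $i\in[n-1]$ with $\pi(i)>\pi(i+1)$. The identity is understood in the formal power series ring $\mathbb{Q}[[t]]$, with $\sqrt{1-t}$ the power series with constant term $1$ (then $w$ is a power series in $t$ with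 zero constant term). *)

theory Defs
  imports
    "HOL-Combinatorics.Combinatorics"
    "HOL-Computational_Algebra.Computational_Algebra"
begin

definition cval :: "nat \<Rightarrow> (nat \<Rightarrow> nat) \<Rightarrow> nat" where
  "cval n \<pi> = card {i \<in> {1..n}. inv \<pi> i > i \<and> i < \<pi> i}"

definition des :: "nat \<Rightarrow> (nat \<Rightarrow> nat) \<Rightarrow> nat" where
  "des n \<pi> = card {i \<in> {1..<n}. \<pi> i > \<pi> (i + 1)}"

text \<open>
  The cycles of \<^term>\<open>\<pi>\<close> are its orbits, with fixed points as cycles of length 1;
  \<^const>\<open>image_mset\<close> keeps cycle lengths with multiplicity.
\<close>
definition cycle_type :: "nat \<Rightarrow> (nat \<Rightarrow> nat) \<Rightarrow> nat multiset" where
  "cycle_type n \<pi> = image_mset card (mset_set (orbit \<pi> ` {1..n}))"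

definition perms_of_type :: "nat \<Rightarrow> nat multiset \<Rightarrow> (nat \<Rightarrow> nat) set" where
  "perms_of_type n lam = {\<pi>. \<pi> permutes {1..n} \<and> cycle_type n \<pi> = lam}"

text \<open>
  A partition is the multiset of its parts, so \<^term>\<open>count lam i\<close> is $m_i$.
  Indices $i$ that are not parts contribute the factor 1, so the product is over the parts only.
\<close>
definition z_part :: "nat multiset \<Rightarrow> nat" where
  "z_part lam = (\<Prod>i\<in>set_mset lam. i ^ count lam i * fact (count lam i))"

text \<open>
  The coefficient type is left generic so that the polynomial can be evaluated directly at a
  power series with \<^const>\<open>poly\<close>.
\<close>
definition eulerian_poly :: "nat \<Rightarrow> 'a :: comm_semiring_1 poly" where
  "eulerian_poly n =
     (if n = 0 then 1 else (\<Sum>\<pi> | \<pi> permutes {1..n}. monom 1 (des n \<pi> + 1)))"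

text \<open>
  The first argument of \<^const>\<open>fps_radical\<close> chooses the root of the constant term;
  here the square root 1 of 1.
\<close>
definition sqrt_one_minus_X :: "rat fps" where
  "sqrt_one_minus_X = fps_radical (\<lambda>_ _. 1) 2 (1 - fps_X)"

definition w_fps :: "rat fps" where
  "w_fps = 2 * (1 - sqrt_one_minus_X) / fps_X - 1"

lemma sqrt_one_minus_X_power2: "sqrt_one_minus_X ^ 2 = 1 - fps_X"
proof -
  have "(fps_radical (\<lambda>_ _. 1) (Suc 1) (1 - fps_X :: rat fps)) ^ Suc 1 = 1 - fps_X"
    by (subst power_radical [symmetric]) simp_all
  then show ?thesis
    by (simp add: sqrt_one_minus_X_def numeral_2_eq_2)
qed

lemma sqrt_one_minus_X_nth_0: "fps_nth sqrt_one_minus_X 0 = 1"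
  by (simp add: sqrt_one_minus_X_def fps_radical_def numeral_2_eq_2)

lemma sqrt_one_minus_X_unique:
  fixes f :: "rat fps"
  assumes "f ^ 2 = 1 - fps_X" and "fps_nth f 0 = 1"
  shows "f = sqrt_one_minus_X"
proof -
  have "f ^ 2 = sqrt_one_minus_X ^ 2"
    using assms(1) by (simp add: sqrt_one_minus_X_power2)
  then have "f = sqrt_one_minus_X \<or> f = - sqrt_one_minus_X"
    by (simp add: power2_eq_iff)
  moreover have "f \<noteq> - sqrt_one_minus_X"
    using assms(2) sqrt_one_minus_X_nth_0 by auto
  ultimately show ?thesis by blast
qed

lemma fps_X_times_w_fps: "fps_X * (w_fps + 1) = 2 * (1 - sqrt_one_minus_X)"
proof -
  have "fps_X dvd (2 * (1 - sqrt_one_minus_X) :: rat fps)"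
  proof -
    have "fps_nth (2 * (1 - sqrt_one_minus_X)) 0 = 0"
      by (simp add: sqrt_one_minus_X_nth_0)
    then show ?thesis
      by (intro dvdI [where k = "fps_shift 1 (2 * (1 - sqrt_one_minus_X))"])
        (auto simp: fps_eq_iff)
  qed
  then show ?thesis
    unfolding w_fps_def diff_add_cancel by (rule dvd_mult_div_cancel)
qed

lemma w_fps_nth_0: "fps_nth w_fps 0 = 0"
proof -
  define s where "s = sqrt_one_minus_X"
  have "fps_nth (s ^ 2) 1 = 2 * fps_nth s 1"
    using sqrt_one_minus_X_nth_0
    by (simp add: s_def power2_eq_square fps_mult_nth)
  then have "fps_nth s 1 = - 1 / 2"
    by (simp add: s_def sqrt_one_minus_X_power2)
  moreover have "fps_nth (fps_X * (w_fps + 1)) 1 = fps_nth (2 * (1 - s)) 1"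
    by (simp only: fps_X_times_w_fps s_def)
  ultimately show ?thesis
    by (simp add: fps_mult_nth numeral_fps_const)
qed

end

theory Submission
  imports Defs
begin

text \<open>
  Let $C_k(t)$ enumerate the cyclic permutations of a $k$-element set by cyclic valleys. Inserting a
  new maximum into one of the $k$ arcs of a cycle with $v$ valleys creates a valley for exactly
  $k - 2v$ arcs, so $C_{k+1} = k t C_k + 2 t (1 - t) C_k'$ for $k \<ge> 2$. Inserting a maximum into a word
  gives $A_{n+1} = (n + 1) x A_n + x (1 - x) A_n'$ for $n \<ge> 1$. With $s = \sqrt{1 - t}$ one has
  $w = (1 - s) / (1 + s)$, and the substitution $x = w$ turns the second recurrence into the first:
  $C_k = (1 + s)^k A_{k-1}(w)$ for $k \<ge> 2$, whereas $C_1 = 1$. Splitting a permutation into the cycle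
  through a fixed element and the rest then gives the product formula by induction.
\<close>

section \<open>Eulerian polynomials\<close>

text \<open>The choice of w comes from the equation 4 w = t (1 + w)^2, of which it is the solution
  with zero constant term. For n >= 1 the polynomial A_n is palindromic with centre (n + 1) / 2,
  hence a combination of the products x^i (1 + x)^(n + 1 - 2 i). As 1 + w = 2 / (1 + s), the factor
  (1 + s)^(n + 1) turns each such product at x = w into a constant multiple of t^i, which explains
  why s disappears from C_k. Matching the two recurrences confirms this directly. Cycles of length 1
  are the exception: the closed form would give 1 + s instead of 1. Hence the induction on the cycle
  length starts at C_2 = t = (1 + s)^2 w, and the exponent of 1 + s is n - m_1 instead of n.\<close>

fun descents :: "'a :: linorder list \<Rightarrow> nat" where
  "descents (x # y # zs) = of_bool (x > y) + descents (y # zs)"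
| "descents _ = 0"

lemma descents_conv_sum:
  "descents xs = (\<Sum>i<length xs - 1. of_bool (xs ! i > xs ! Suc i))"
proof (induction xs rule: descents.induct)
  case (1 x y zs)
  then show ?case
    by (simp add: sum.lessThan_Suc_shift del: sum.lessThan_Suc)
qed auto

lemma des_conv_descents: "des n \<pi> = descents (map \<pi> [1..<Suc n])"
proof -
  have "des n \<pi> = (\<Sum>i\<in>{1..<n}. of_bool (\<pi> i > \<pi> (i + 1)))"
    by (simp add: des_def Int_def)
  also have "\<dots> = (\<Sum>i<n - 1. of_bool (\<pi> (Suc i) > \<pi> (Suc (Suc i))))"
    by (rule sum.reindex_bij_witness[where i = Suc and j = "\<lambda>i. i - 1"]) auto
  also have "\<dots> = descents (map \<pi> [1..<Suc n])"
    unfolding descents_conv_sum by (rule sum.cong) (auto simp del: upt_Suc)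
  finally show ?thesis .
qed

text \<open>The maximum is never followed by a larger letter nor preceded by one. Placed into a
  descent or at the end it keeps the number of descents; at any other place it adds one. The weight
  \<open>f\<close> is arbitrary because the induction applies the hypothesis to a shifted
  weight.\<close>

lemma sum_descents_insert_greatest:
  fixes f :: "nat \<Rightarrow> 'b :: comm_ring_1"
  assumes "\<And>y. y \<in> set ys \<Longrightarrow> y < m"
  shows "(\<Sum>p\<le>length ys. f (descents (take p ys @ m # drop p ys))) =
    of_nat (descents ys + 1) * f (descents ys) +
    (of_nat (length ys) - of_nat (descents ys)) * f (descents ys + 1)"
  using assms
proof (induction ys arbitrary: f rule: descents.induct)
  case (1 y z zs)
  define b :: nat where "b = of_bool (y > z)"
  define d where "d = descents (z # zs)"
  define g where "g p = descents (take p (z # zs) @ m # drop p (z # zs))" for p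
  have lt: "y < m" "z < m" using 1 by auto
  have IH: "(\<Sum>p\<le>length (z # zs). f (b + g p)) =
      of_nat (d + 1) * f (b + d) + (of_nat (length (z # zs)) - of_nat d) * f (b + (d + 1))"
    using "1.IH"[of "\<lambda>k. f (b + k)"] "1.prems" by (simp add: d_def g_def)
  have g0: "g 0 = Suc d" using lt by (simp add: g_def d_def)
  \<comment> \<open>Places 0 and 1 are special: in front of \<open>y\<close> the maximum adds a
    descent, and between \<open>y\<close> and \<open>z\<close> it replaces the comparison
    \<open>b\<close> by one descent. From place 2 on the pair \<open>y\<close>, \<open>z\<close>
    stays adjacent and contributes \<open>b\<close>.\<close>
  have "(\<Sum>p\<le>length (y # z # zs). f (descents (take p (y # z # zs) @ m # drop p (y # z # zs)))) =
      f (Suc (b + d)) + (f (Suc d) + (\<Sum>p\<le>length zs. f (b + g (Suc p))))"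
    using lt by (simp add: sum.atMost_Suc_shift g_def d_def b_def not_less_iff_gr_or_eq less_not_sym del: sum.atMost_Suc)
  moreover have "(\<Sum>p\<le>length (z # zs). f (b + g p)) =
      f (b + Suc d) + (\<Sum>p\<le>length zs. f (b + g (Suc p)))"
    by (simp add: sum.atMost_Suc_shift g0 del: sum.atMost_Suc)
  ultimately have *: "(\<Sum>p\<le>length (y # z # zs). f (descents (take p (y # z # zs) @ m # drop p (y # z # zs)))) =
      f (Suc d) + (of_nat (d + 1) * f (b + d) + (of_nat (length (z # zs)) - of_nat d) * f (b + (d + 1)))"
    using IH by simp
  have "descents (y # z # zs) = b + d" by (simp add: b_def d_def)
  show ?case
    unfolding * d_def[symmetric] \<open>descents (y # z # zs) = b + d\<close>
    by (cases "y > z") (simp_all add: b_def algebra_simps)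
next
  case ("2_2" y)
  then show ?case by (auto simp: not_less_iff_gr_or_eq)
qed auto

text \<open>Deleting \<open>m\<close> while recording the length of the prefix before it inverts the
  insertion, so every word on the larger set arises exactly once.\<close>

lemma sum_permutations_of_set_insert:
  assumes "finite A" "m \<notin> A"
  shows "(\<Sum>xs\<in>permutations_of_set (insert m A). h xs) =
    (\<Sum>ys\<in>permutations_of_set A. \<Sum>p\<le>length ys. h (take p ys @ m # drop p ys))"
proof -
  let ?S = "SIGMA ys:permutations_of_set A. {..length ys}"
  have "(\<Sum>xs\<in>permutations_of_set (insert m A). h xs) =
      (\<Sum>(ys, p)\<in>?S. h (take p ys @ m # drop p ys))"
  proof (rule sum.reindex_bij_witness[where
        i = "\<lambda>(ys, p). take p ys @ m # drop p ys" and
        j = "\<lambda>xs. (remove1 m xs, length (takeWhile (\<lambda>x. x \<noteq> m) xs))"])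
    fix xs assume xs: "xs \<in> permutations_of_set (insert m A)"
    then obtain us vs where split: "xs = us @ m # vs" "m \<notin> set us"
      by (metis insertI1 permutations_of_setD(1) split_list_first)
    have tw: "takeWhile (\<lambda>x. x \<noteq> m) xs = us"
      using split by (subst split(1), subst takeWhile_append2) auto
    have rm: "remove1 m xs = us @ vs"
      using split by (simp add: remove1_append)
    have "distinct xs" "set xs = insert m A" using xs by (auto dest: permutations_of_setD)
    then have "distinct (us @ vs)" "set (us @ vs) = A"
      using split assms by auto
    then show "(remove1 m xs, length (takeWhile (\<lambda>x. x \<noteq> m) xs)) \<in> ?S"
      unfolding rm tw by (auto intro!: permutations_of_setI)
    show "(case (remove1 m xs, length (takeWhile (\<lambda>x. x \<noteq> m) xs)) of
        (ys, p) \<Rightarrow> take p ys @ m # drop p ys) = xs"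
      unfolding rm tw using split by simp
    then show "(case (remove1 m xs, length (takeWhile (\<lambda>x. x \<noteq> m) xs)) of
        (ys, p) \<Rightarrow> h (take p ys @ m # drop p ys)) = h xs"
      by simp
  next
    fix a assume a: "a \<in> ?S"
    obtain ys p where [simp]: "a = (ys, p)" by (cases a)
    have p: "p \<le> length ys" and ys: "set ys = A" "distinct ys"
      using a by (auto dest: permutations_of_setD)
    have "m \<notin> set ys" using ys assms by auto
    then have m: "m \<notin> set (take p ys)" "m \<notin> set (drop p ys)"
      by (meson in_set_takeD in_set_dropD)+
    then have "takeWhile (\<lambda>x. x \<noteq> m) (take p ys @ m # drop p ys) = take p ys"
      using m by (subst takeWhile_append2) auto
    moreover have "remove1 m (take p ys @ m # drop p ys) = ys"
      using m by (simp add: remove1_append)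
    ultimately show "(remove1 m (case a of (ys, p) \<Rightarrow> take p ys @ m # drop p ys),
        length (takeWhile (\<lambda>x. x \<noteq> m) (case a of (ys, p) \<Rightarrow> take p ys @ m # drop p ys))) = a"
      using p by simp
    have "set (take p ys @ m # drop p ys) = insert m (set (take p ys @ drop p ys))"
      by (simp del: append_take_drop_id)
    then have "set (take p ys @ m # drop p ys) = insert m A"
      using ys by simp
    moreover have "distinct (take p ys @ m # drop p ys)"
      using ys m by (simp add: set_take_disj_set_drop_if_distinct)
    ultimately show "(case a of (ys, p) \<Rightarrow> take p ys @ m # drop p ys)
        \<in> permutations_of_set (insert m A)"
      by (simp add: permutations_of_setI)
  qed
  also have "\<dots> = (\<Sum>ys\<in>permutations_of_set A. \<Sum>p\<le>length ys. h (take p ys @ m # drop p ys))"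
    by (rule sum.Sigma[symmetric]) auto
  finally show ?thesis .
qed

lemma bij_betw_permutes_permutations_of_set:
  assumes "distinct xs"
  shows "bij_betw (\<lambda>\<pi>. map \<pi> xs) {\<pi>. \<pi> permutes set xs} (permutations_of_set (set xs))"
proof (rule bij_betw_imageI)
  show inj: "inj_on (\<lambda>\<pi>. map \<pi> xs) {\<pi>. \<pi> permutes set xs}"
  proof (rule inj_onI, simp, rule ext)
    fix \<pi> \<rho> x
    assume "\<pi> permutes set xs" "\<rho> permutes set xs" "\<forall>x\<in>set xs. \<pi> x = \<rho> x"
    then show "\<pi> x = \<rho> x" by (cases "x \<in> set xs") (auto simp: permutes_not_in)
  qed
  show "(\<lambda>\<pi>. map \<pi> xs) ` {\<pi>. \<pi> permutes set xs} = permutations_of_set (set xs)"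
  proof (rule card_subset_eq)
    show "(\<lambda>\<pi>. map \<pi> xs) ` {\<pi>. \<pi> permutes set xs} \<subseteq> permutations_of_set (set xs)"
      using assms by (auto simp: distinct_map permutes_image permutes_inj_on intro!: permutations_of_setI)
    show "card ((\<lambda>\<pi>. map \<pi> xs) ` {\<pi>. \<pi> permutes set xs}) = card (permutations_of_set (set xs))"
      by (simp add: card_image[OF inj] card_permutations)
  qed simp
qed

text \<open>One-line notation: inserting a maximum shifts all later positions, which is immediate
  for words but awkward for functions on \<open>{1..n}\<close>.\<close>

lemma eulerian_poly_conv_descents:
  assumes "n > 0"
  shows "eulerian_poly n = (\<Sum>xs\<in>permutations_of_set {1..n}. monom 1 (descents xs + 1))"
proof -
  have "bij_betw (\<lambda>\<pi>. map \<pi> [1..<Suc n]) {\<pi>. \<pi> permutes {1..n}} (permutations_of_set {1..n})"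
    using bij_betw_permutes_permutations_of_set[of "[1..<Suc n]"]
    by (simp add: atLeastLessThanSuc_atLeastAtMost del: upt_Suc)
  then show ?thesis
    using assms unfolding eulerian_poly_def des_conv_descents
    by (simp add: sum.reindex_bij_betw[symmetric] del: upt_Suc)
qed

lemma eulerian_poly_1: "eulerian_poly (Suc 0) = monom 1 1"
  by (subst eulerian_poly_conv_descents) simp_all

text \<open>A word with d descents produces (d + 1) x^(d+1) + (n - d) x^(d+2), and the factor d + 1
  is what x d/dx extracts from x^(d+1). The coefficient ring is kept general because the polynomial
  is later evaluated with power series as coefficients.\<close>

lemma eulerian_poly_Suc:
  assumes "n > 0"
  shows "(eulerian_poly (Suc n) :: 'a :: idom poly) =
    of_nat (Suc n) * monom 1 1 * eulerian_poly n +
    monom 1 1 * (1 - monom 1 1) * pderiv (eulerian_poly n)"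
proof -
  have step: "(\<Sum>p\<le>length ys. monom 1 (descents (take p ys @ Suc n # drop p ys) + 1)) =
      of_nat (Suc n) * monom 1 1 * monom (1 :: 'a) (descents ys + 1) +
      monom 1 1 * (1 - monom 1 1) * pderiv (monom 1 (descents ys + 1))"
    if ys: "ys \<in> permutations_of_set {1..n}" for ys
  proof -
    have len: "length ys = n" and lt: "\<And>y. y \<in> set ys \<Longrightarrow> y < Suc n"
      using length_finite_permutations_of_set[OF ys] ys by (auto dest: permutations_of_setD)
    have X: "monom (1 :: 'a) (Suc k) = monom 1 1 * monom 1 k" for k
      by (simp add: mult_monom)
    have pd: "pderiv (monom (1 :: 'a) (Suc k)) = of_nat (Suc k) * monom 1 k" for k
      by (simp add: pderiv_monom of_nat_monom mult_monom)
    have "(\<Sum>p\<le>length ys. monom 1 (descents (take p ys @ Suc n # drop p ys) + 1)) =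
      of_nat (descents ys + 1) * monom (1 :: 'a) (descents ys + 1) +
      (of_nat n - of_nat (descents ys)) * monom 1 (descents ys + 2)"
      using sum_descents_insert_greatest[of ys "Suc n", OF lt, where ?f = "\<lambda>k. monom (1 :: 'a) (k + 1)"] len by simp
    also have "\<dots> = of_nat (Suc n) * monom 1 1 * monom (1 :: 'a) (descents ys + 1) +
      monom 1 1 * (1 - monom 1 1) * pderiv (monom 1 (descents ys + 1))"
      unfolding Suc_eq_plus1[symmetric] pd add_2_eq_Suc' X[of "Suc (descents ys)"]
      unfolding X[of "descents ys"] by (simp add: algebra_simps)
    finally show ?thesis .
  qed
  have "{1..Suc n} = insert (Suc n) {1..n}" by auto
  then have "(eulerian_poly (Suc n) :: 'a poly) = (\<Sum>ys\<in>permutations_of_set {1..n}.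
      of_nat (Suc n) * monom 1 1 * monom 1 (descents ys + 1) +
      monom 1 1 * (1 - monom 1 1) * pderiv (monom 1 (descents ys + 1)))"
    using step by (simp add: eulerian_poly_conv_descents sum_permutations_of_set_insert)
  also have "\<dots> = of_nat (Suc n) * monom 1 1 * eulerian_poly n +
      monom 1 1 * (1 - monom 1 1) * pderiv (eulerian_poly n)"
    by (simp only: eulerian_poly_conv_descents[OF assms] sum.distrib sum_distrib_left
          higher_pderiv_sum[of 1, simplified])
  finally show ?thesis .
qed

section \<open>Cyclic permutations\<close>

text \<open>The ground set is arbitrary because splitting off a cycle of a permutation of
  \<open>{1..n}\<close> need not leave an interval.\<close>

definition cyclic_valleys :: "nat set \<Rightarrow> (nat \<Rightarrow> nat) \<Rightarrow> nat set" where
  "cyclic_valleys A \<pi> = {i \<in> A. inv \<pi> i > i \<and> i < \<pi> i}"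

definition cyclic_perms :: "'a set \<Rightarrow> ('a \<Rightarrow> 'a) set" where
  "cyclic_perms A = {\<sigma>. \<sigma> permutes A \<and> cyclic_on \<sigma> A}"

lemma finite_cyclic_perms: "finite A \<Longrightarrow> finite (cyclic_perms A)"
  by (rule finite_subset[OF _ finite_permutations]) (auto simp: cyclic_perms_def)

section \<open>Cyclic valleys under insertion of a new maximum\<close>

text \<open>\<open>\<tau>\<close> passes from \<open>i\<close> through \<open>m\<close> to
  \<open>\<sigma> i\<close>. Only the successor of \<open>i\<close> and the predecessor of
  \<open>\<sigma> i\<close> change, both to the larger \<open>m\<close>, so no valley is lost. At
  the smaller end of the old arc the neighbour was already larger; hence a valley can arise only at
  the larger end, and does so if its other neighbour is larger too.\<close>

lemma cyclic_valleys_insert: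
  fixes A :: "nat set"
  assumes \<sigma>: "\<sigma> permutes A" and i: "i \<in> A" "\<sigma> i \<noteq> i" and m: "\<And>x. x \<in> A \<Longrightarrow> x < m"
  defines "\<tau> \<equiv> \<sigma> \<circ> transpose i m"
  shows "cyclic_valleys (insert m A) \<tau> = cyclic_valleys A \<sigma> \<union>
    (if i < \<sigma> i then if \<sigma> i < \<sigma> (\<sigma> i) then {\<sigma> i} else {}
     else if i < inv \<sigma> i then {i} else {})"
proof -
  have mA: "m \<notin> A" using m by blast
  have bij: "bij \<sigma>" using \<sigma> by (rule permutes_bij)
  have inv_\<tau>: "inv \<tau> x = transpose i m (inv \<sigma> x)" for x
    unfolding \<tau>_def by (simp add: o_inv_distrib[OF bij])
  have \<sigma>m: "\<sigma> m = m" using \<sigma> mA by (simp add: permutes_not_in)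
  have \<sigma>A: "\<sigma> x \<in> A" "inv \<sigma> x \<in> A" if "x \<in> A" for x
    using that \<sigma> by (simp_all add: permutes_in_image permutes_inv)
  have inv_eq: "inv \<sigma> x = y \<longleftrightarrow> \<sigma> y = x" for x y
    using bij by (metis bij_inv_eq_iff)
  have \<tau>: "\<tau> i = m" "\<tau> m = \<sigma> i" "\<And>x. x \<noteq> i \<Longrightarrow> x \<noteq> m \<Longrightarrow> \<tau> x = \<sigma> x"
    by (auto simp: \<tau>_def \<sigma>m)
  have \<tau>': "inv \<tau> m = i" "inv \<tau> (\<sigma> i) = m" "\<And>x. x \<noteq> \<sigma> i \<Longrightarrow> x \<noteq> m \<Longrightarrow> inv \<tau> x = inv \<sigma> x"
    unfolding inv_\<tau> using \<sigma>m inv_eq \<sigma>A(1)[OF i(1)] i mA by (auto simp: transpose_def)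
  have mem: "x \<in> cyclic_valleys (insert m A) \<tau> \<longleftrightarrow> x \<in> cyclic_valleys A \<sigma> \<union>
    (if i < \<sigma> i then if \<sigma> i < \<sigma> (\<sigma> i) then {\<sigma> i} else {}
     else if i < inv \<sigma> i then {i} else {})" for x
  proof -
    consider "x = m" | "x \<noteq> m" "x = i" | "x \<noteq> m" "x = \<sigma> i" | "x \<noteq> m" "x \<noteq> i" "x \<noteq> \<sigma> i" by blast
    then show ?thesis
    proof cases
      case 1
      then show ?thesis using m[OF i(1)] m[OF \<sigma>A(1)[OF i(1)]] mA
        by (auto simp: cyclic_valleys_def \<tau>' dest: less_not_sym)
    next
      case 2
      then show ?thesis using m i \<sigma>A mA by (auto simp: cyclic_valleys_def \<tau>' \<tau>)
    next
      case 3
      have "inv \<sigma> (\<sigma> i) = i" by (simp add: inv_eq)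
      with 3 show ?thesis using m[OF \<sigma>A(1)[OF i(1)]] i \<sigma>A mA
        by (auto simp: cyclic_valleys_def \<tau>' \<tau>)
    next
      case 4
      then show ?thesis by (auto simp: cyclic_valleys_def \<tau>' \<tau>)
    qed
  qed
  show ?thesis using mem by blast
qed

text \<open>
  Inserting a new maximum after \<open>i\<close> creates a valley exactly when the smaller end of the arc from
  \<open>i\<close> to \<open>\<sigma> i\<close> is a double ascent or a double descent. Valleys and peaks are
  equinumerous, which leaves \<open>k - 2v\<close> such arcs.
\<close>

lemma card_valley_creating_positions:
  fixes A :: "nat set"
  assumes \<sigma>: "\<sigma> permutes A" and "finite A" and nofix: "\<And>x. x \<in> A \<Longrightarrow> \<sigma> x \<noteq> x"
  shows "card {i \<in> A. if i < \<sigma> i then \<sigma> i < \<sigma> (\<sigma> i) else i < inv \<sigma> i} +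
    2 * card (cyclic_valleys A \<sigma>) = card A"
proof -
  define asc where "asc = {i \<in> A. i < \<sigma> i}"
  define dsc where "dsc = {i \<in> A. \<sigma> i < i}"
  define dasc where "dasc = {i \<in> A. i < \<sigma> i \<and> \<sigma> i < \<sigma> (\<sigma> i)}"
  define ddsc where "ddsc = {i \<in> A. \<sigma> i < i \<and> i < inv \<sigma> i}"
  define V where "V = cyclic_valleys A \<sigma>"
  have inv[simp]: "inv \<sigma> (\<sigma> x) = x" "\<sigma> (inv \<sigma> x) = x" for x
    using \<sigma> by (simp_all add: permutes_inverses)
  have mem[simp]: "\<sigma> x \<in> A \<longleftrightarrow> x \<in> A" "inv \<sigma> x \<in> A \<longleftrightarrow> x \<in> A" for x
    using \<sigma> by (simp_all add: permutes_in_image permutes_inv)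
  have fin: "finite asc" "finite dsc" "finite dasc" "finite ddsc" "finite V"
    using \<open>finite A\<close> by (simp_all add: asc_def dsc_def dasc_def ddsc_def V_def cyclic_valleys_def)
  have inj: "inj_on \<sigma> B" for B using \<sigma> by (rule permutes_inj_on)
  have invneq: "inv \<sigma> x \<noteq> x" if "x \<in> A" for x
    using nofix[OF that] by (metis inv(2))
  \<comment> \<open>\<open>dasc\<close> names a double ascent by its predecessor, hence the image
    under \<open>\<sigma>\<close>. The start of an ascent is a double ascent or a valley, according
    to whether its predecessor is smaller or larger.\<close>
  have "asc = \<sigma> ` dasc \<union> V"
  proof (intro equalityI subsetI)
    fix x assume x: "x \<in> asc"
    then have "x \<in> A" by (simp add: asc_def)
    show "x \<in> \<sigma> ` dasc \<union> V"
    proof (cases "x < inv \<sigma> x")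
      case False
      then have "inv \<sigma> x \<in> dasc"
        using x invneq[OF \<open>x \<in> A\<close>] by (auto simp: asc_def dasc_def)
      then have "\<sigma> (inv \<sigma> x) \<in> \<sigma> ` dasc" by blast
      then show ?thesis by simp
    qed (use x in \<open>auto simp: asc_def V_def cyclic_valleys_def\<close>)
  qed (auto simp: asc_def dasc_def V_def cyclic_valleys_def)
  moreover have "\<sigma> ` dasc \<inter> V = {}"
    by (auto simp: dasc_def V_def cyclic_valleys_def)
  ultimately have 1: "card asc = card dasc + card V"
    using fin by (simp add: card_Un_disjoint card_image[OF inj])
  \<comment> \<open>The same dichotomy for the ends of descents. Every valley is thus counted twice,
    as the start of an ascent and as the end of a descent, which is the source of the factor
    2.\<close>
  have "\<sigma> ` dsc = ddsc \<union> V"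
  proof (intro equalityI subsetI)
    fix x assume "x \<in> \<sigma> ` dsc"
    then have x: "x \<in> A" "x < inv \<sigma> x" by (auto simp: dsc_def)
    then show "x \<in> ddsc \<union> V"
      using nofix[of x] by (auto simp: ddsc_def V_def cyclic_valleys_def)
  next
    fix x assume "x \<in> ddsc \<union> V"
    then have "inv \<sigma> x \<in> dsc" by (auto simp: ddsc_def V_def cyclic_valleys_def dsc_def)
    then have "\<sigma> (inv \<sigma> x) \<in> \<sigma> ` dsc" by blast
    then show "x \<in> \<sigma> ` dsc" by simp
  qed
  moreover have "ddsc \<inter> V = {}" by (auto simp: ddsc_def V_def cyclic_valleys_def)
  ultimately have 2: "card dsc = card ddsc + card V"
    using fin by (metis card_Un_disjoint card_image[OF inj])
  have "A = asc \<union> dsc" "asc \<inter> dsc = {}"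
    using nofix by (auto simp: asc_def dsc_def not_less_iff_gr_or_eq)
  then have 3: "card A = card asc + card dsc" using fin by (simp add: card_Un_disjoint)
  have "{i \<in> A. if i < \<sigma> i then \<sigma> i < \<sigma> (\<sigma> i) else i < inv \<sigma> i} = dasc \<union> ddsc"
    using nofix[THEN nat_neq_iff[THEN iffD1]] by (auto simp: dasc_def ddsc_def dest: less_not_sym)
  moreover have "dasc \<inter> ddsc = {}" by (auto simp: dasc_def ddsc_def)
  ultimately show ?thesis
    using 1 2 3 fin by (simp add: card_Un_disjoint V_def)
qed

lemma sum_insert_greatest_cyclic_valleys:
  fixes A :: "nat set" and f :: "nat \<Rightarrow> 'b :: comm_ring_1"
  assumes \<sigma>: "\<sigma> permutes A" and fin: "finite A" and nofix: "\<And>x. x \<in> A \<Longrightarrow> \<sigma> x \<noteq> x"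
    and m: "\<And>x. x \<in> A \<Longrightarrow> x < m"
  defines "v \<equiv> card (cyclic_valleys A \<sigma>)"
  shows "(\<Sum>i\<in>A. f (card (cyclic_valleys (insert m A) (\<sigma> \<circ> transpose i m)))) =
    of_nat (2 * v) * f v + (of_nat (card A) - of_nat (2 * v)) * f (v + 1)"
proof -
  define P where "P i \<longleftrightarrow> (if i < \<sigma> i then \<sigma> i < \<sigma> (\<sigma> i) else i < inv \<sigma> i)" for i
  have inv: "inv \<sigma> (\<sigma> i) = i" for i using \<sigma> by (simp add: permutes_inverses)
  have "card (cyclic_valleys (insert m A) (\<sigma> \<circ> transpose i m)) = v + of_bool (P i)" if "i \<in> A" for i
  proof -
    have "finite (cyclic_valleys A \<sigma>)" using fin by (simp add: cyclic_valleys_def)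
    \<comment> \<open>The point that may be gained was not a valley before, so the count rises by
      exactly one.\<close>
    moreover have "\<sigma> i \<notin> cyclic_valleys A \<sigma>" if "i < \<sigma> i"
      using that by (simp add: cyclic_valleys_def inv)
    moreover have "i \<notin> cyclic_valleys A \<sigma>" if "\<not> i < \<sigma> i"
      using that by (simp add: cyclic_valleys_def)
    ultimately show ?thesis
      by (subst cyclic_valleys_insert[OF \<sigma> that nofix[OF that] m]) (simp_all add: P_def v_def)
  qed
  then have "(\<Sum>i\<in>A. f (card (cyclic_valleys (insert m A) (\<sigma> \<circ> transpose i m)))) =
      (\<Sum>i\<in>A. if P i then f (v + 1) else f v)"
    by (intro sum.cong) auto
  also have "\<dots> = of_nat (card {i \<in> A. P i}) * f (v + 1) + of_nat (card {i \<in> A. \<not> P i}) * f v"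
    using fin by (simp add: sum.If_cases Int_def)
  also have "card {i \<in> A. \<not> P i} = card A - card {i \<in> A. P i}"
    using fin by (subst card_Diff_subset[symmetric]) (auto intro!: arg_cong[where f = card])
  also have "card {i \<in> A. P i} = card A - 2 * v"
    using card_valley_creating_positions[OF \<sigma> fin nofix] by (simp add: P_def v_def)
  also have "card A - (card A - 2 * v) = 2 * v"
    using card_valley_creating_positions[OF \<sigma> fin nofix] by (simp add: v_def)
  also have "of_nat (card A - 2 * v) = (of_nat (card A) - of_nat (2 * v) :: 'b)"
    using card_valley_creating_positions[OF \<sigma> fin nofix] by (simp add: v_def of_nat_diff)
  finally show ?thesis by (simp only: add.commute)
qed

section \<open>Insertion and removal of a point in a cycle\<close>

text \<open>Starting at \<open>m\<close>, the new permutation reaches \<open>\<sigma> i\<close> and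
  then follows \<open>\<sigma>\<close>, with a detour through \<open>m\<close> whenever it leaves
  \<open>i\<close>; so its orbit contains the whole \<open>\<sigma>\<close>-orbit of
  \<open>i\<close>.\<close>

lemma cyclic_perms_insert:
  assumes "m \<notin> A" "\<sigma> \<in> cyclic_perms A" "i \<in> A"
  shows "\<sigma> \<circ> transpose i m \<in> cyclic_perms (insert m A)"
proof -
  let ?\<tau> = "\<sigma> \<circ> transpose i m"
  have \<sigma>: "\<sigma> permutes A" "cyclic_on \<sigma> A" using assms by (auto simp: cyclic_perms_def)
  have fin: "finite A" using \<sigma>(2) by (rule finite_cyclic_on)
  have perm: "?\<tau> permutes insert m A"
    using \<sigma>(1) assms by (intro permutes_compose permutes_swap_id permutes_subset[OF \<sigma>(1)]) auto
  have \<sigma>m: "\<sigma> m = m" using \<sigma> assms by (simp add: permutes_not_in)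
  have \<tau>: "?\<tau> i = m" "?\<tau> m = \<sigma> i" "\<And>x. x \<noteq> i \<Longrightarrow> x \<noteq> m \<Longrightarrow> ?\<tau> x = \<sigma> x"
    by (auto simp: \<sigma>m)
  have m_in: "m \<in> orbit ?\<tau> m"
    using perm fin by (intro permutation_self_in_orbit permutes_imp_permutation[of "insert m A"]) auto
  have "y \<in> orbit ?\<tau> m" if "y \<in> orbit \<sigma> i" for y
    using that
  proof induction
    case base
    then show ?case using orbit.base[of ?\<tau> m] by (simp only: \<tau>)
  next
    case (step y)
    have "y \<noteq> m"
      using step.hyps \<sigma> assms by (metis orbit_cyclic_eq3)
    then show ?case
      using step.IH \<tau> orbit.base[of ?\<tau> m] by (cases "y = i") (metis orbit.step)+
  qed
  then have "A \<subseteq> orbit ?\<tau> m"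
    using orbit_cyclic_eq3[OF \<sigma>(2) assms(3)] by blast
  moreover have "orbit ?\<tau> m \<subseteq> insert m A"
    using perm by (rule permutes_orbit_subset) simp
  ultimately have "orbit ?\<tau> m = insert m A" using m_in by blast
  with perm show ?thesis
    by (auto simp: cyclic_perms_def intro: cyclic_on_singleI)
qed

text \<open>The same transposition now makes the cycle bypass \<open>m\<close>: its predecessor goes
  straight to its successor, and \<open>m\<close> becomes fixed. Since \<open>A\<close> is nonempty,
  the predecessor differs from \<open>m\<close>.\<close>

lemma cyclic_perms_remove:
  assumes "m \<notin> A" "A \<noteq> {}" "\<tau> \<in> cyclic_perms (insert m A)"
  shows "inv \<tau> m \<in> A" "\<tau> \<circ> transpose (inv \<tau> m) m \<in> cyclic_perms A"
proof -
  define i where "i = inv \<tau> m"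
  let ?\<sigma> = "\<tau> \<circ> transpose i m"
  have \<tau>: "\<tau> permutes insert m A" "cyclic_on \<tau> (insert m A)"
    using assms by (auto simp: cyclic_perms_def)
  have \<tau>i: "\<tau> i = m" using \<tau>(1) by (simp add: i_def permutes_inverses)
  have "i \<noteq> m"
  proof
    assume "i = m"
    then have "orbit \<tau> m = {m}" using \<tau>i by (simp add: orbit_eq_singleton_iff)
    with orbit_cyclic_eq3[OF \<tau>(2), of m] assms show False by auto
  qed
  moreover have "i \<in> insert m A"
    using permutes_in_image[OF permutes_inv[OF \<tau>(1)]] by (simp add: i_def)
  ultimately show iA: "inv \<tau> m \<in> A" by (simp add: i_def)
  then have iA': "i \<in> A" by (simp add: i_def)
  have "?\<sigma> permutes insert m A"
    using \<tau>(1) iA' by (intro permutes_compose permutes_swap_id) auto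
  then have perm: "?\<sigma> permutes A"
    by (rule permutes_superset) (auto simp: \<tau>i)
  have \<sigma>: "?\<sigma> i = \<tau> m" "\<And>x. x \<noteq> i \<Longrightarrow> x \<noteq> m \<Longrightarrow> ?\<sigma> x = \<tau> x" by auto
  have "(y \<noteq> m \<longrightarrow> y \<in> orbit ?\<sigma> i)" if "y \<in> orbit \<tau> m" for y
    using that
  proof induction
    case base
    then show ?case using orbit.base[of ?\<sigma> i] by (simp only: \<sigma> simp_thms)
  next
    case (step y)
    then show ?case
      using \<sigma> \<tau>i orbit.base[of ?\<sigma> i] by (cases "y = m"; cases "y = i") (metis orbit.step)+
  qed
  then have "A \<subseteq> orbit ?\<sigma> i"
    using orbit_cyclic_eq3[OF \<tau>(2), of m] assms(1) by auto
  moreover have "orbit ?\<sigma> i \<subseteq> A" using perm iA' by (rule permutes_orbit_subset)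
  ultimately show "\<tau> \<circ> transpose (inv \<tau> m) m \<in> cyclic_perms A"
    using perm iA' by (auto simp: cyclic_perms_def i_def intro!: cyclic_on_singleI)
qed

lemma sum_cyclic_perms_insert:
  assumes "finite A" "A \<noteq> {}" "m \<notin> A"
  shows "(\<Sum>\<tau>\<in>cyclic_perms (insert m A). h \<tau>) =
    (\<Sum>\<sigma>\<in>cyclic_perms A. \<Sum>i\<in>A. h (\<sigma> \<circ> transpose i m))"
proof -
  have "(\<Sum>\<tau>\<in>cyclic_perms (insert m A). h \<tau>) =
      (\<Sum>(\<sigma>, i)\<in>cyclic_perms A \<times> A. h (\<sigma> \<circ> transpose i m))"
  proof (rule sum.reindex_bij_witness[where
        i = "\<lambda>(\<sigma>, i). \<sigma> \<circ> transpose i m" and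
        j = "\<lambda>\<tau>. (\<tau> \<circ> transpose (inv \<tau> m) m, inv \<tau> m)"])
    fix a assume a: "a \<in> cyclic_perms A \<times> A"
    then obtain \<sigma> i where [simp]: "a = (\<sigma>, i)" and \<sigma>: "\<sigma> \<in> cyclic_perms A" and i: "i \<in> A" by blast
    have p: "\<sigma> permutes A" using \<sigma> by (simp add: cyclic_perms_def)
    have "inv (\<sigma> \<circ> transpose i m) m = i"
      using o_inv_distrib[OF permutes_bij[OF p], of "transpose i m"] permutes_inv[OF p] assms(3)
      by (simp add: permutes_not_in)
    then show "((case a of (\<sigma>, i) \<Rightarrow> \<sigma> \<circ> transpose i m) \<circ>
        transpose (inv (case a of (\<sigma>, i) \<Rightarrow> \<sigma> \<circ> transpose i m) m) m,
        inv (case a of (\<sigma>, i) \<Rightarrow> \<sigma> \<circ> transpose i m) m) = a"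
      by (simp add: o_assoc[symmetric])
    show "(case a of (\<sigma>, i) \<Rightarrow> \<sigma> \<circ> transpose i m) \<in> cyclic_perms (insert m A)"
      using cyclic_perms_insert[OF assms(3) \<sigma> i] by simp
  qed (use cyclic_perms_remove[OF assms(3,2)] in \<open>auto simp: o_assoc[symmetric]\<close>)
  then show ?thesis by (simp add: sum.cartesian_product)
qed

lemma cyclic_perms_singleton: "cyclic_perms {a} = {id}"
  by (auto simp: cyclic_perms_def cyclic_on_def orbit_eq_singleton_iff[THEN iffD2] permutes_sing)

text \<open>A cyclic permutation of k points with v valleys produces 2 v t^v + (k - 2 v) t^(v+1),
  and t d/dt supplies the factor v. Having at least two points excludes fixed points, which would be
  neither ascents nor descents.\<close>

lemma sum_cyclic_valleys_insert:
  fixes A :: "nat set"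
  assumes fin: "finite A" and card: "card A \<ge> 2" and m: "\<And>x. x \<in> A \<Longrightarrow> x < m"
  defines "S \<equiv> \<Sum>\<sigma>\<in>cyclic_perms A. (fps_X :: rat fps) ^ card (cyclic_valleys A \<sigma>)"
  shows "(\<Sum>\<sigma>\<in>cyclic_perms (insert m A). fps_X ^ card (cyclic_valleys (insert m A) \<sigma>)) =
    of_nat (card A) * fps_X * S + 2 * fps_X * (1 - fps_X) * fps_deriv S"
proof -
  have "(\<Sum>\<sigma>\<in>cyclic_perms (insert m A). (fps_X :: rat fps) ^ card (cyclic_valleys (insert m A) \<sigma>)) =
      (\<Sum>\<sigma>\<in>cyclic_perms A. \<Sum>i\<in>A.
        fps_X ^ card (cyclic_valleys (insert m A) (\<sigma> \<circ> transpose i m)))"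
    using card m by (intro sum_cyclic_perms_insert fin) auto
  also have "\<dots> = (\<Sum>\<sigma>\<in>cyclic_perms A.
      of_nat (card A) * fps_X * fps_X ^ card (cyclic_valleys A \<sigma>) +
      2 * fps_X * (1 - fps_X) * fps_deriv (fps_X ^ card (cyclic_valleys A \<sigma>)))"
  proof (rule sum.cong)
    fix \<sigma> assume "\<sigma> \<in> cyclic_perms A"
    then have \<sigma>: "\<sigma> permutes A" "cyclic_on \<sigma> A" by (auto simp: cyclic_perms_def)
    have nofix: "\<sigma> x \<noteq> x" if "x \<in> A" for x
      using eq_on_cyclic_on_iff1[OF \<sigma>(2) that] card by auto
    define v where "v = card (cyclic_valleys A \<sigma>)"
    \<comment> \<open>The exponent \<open>v - 1\<close> in the derivative truncates at
      \<open>v = 0\<close>, where the factor \<open>of_nat v\<close> vanishes.\<close>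
    have "fps_X * fps_deriv (fps_X ^ v) = of_nat v * (fps_X :: rat fps) ^ v"
      unfolding fps_deriv_power' by (cases v) (simp_all add: mult_ac del: of_nat_Suc)
    then have d: "2 * fps_X * (1 - fps_X) * fps_deriv (fps_X ^ v) =
        2 * (1 - fps_X) * (of_nat v * (fps_X :: rat fps) ^ v)"
      by (simp add: mult_ac)
    show "(\<Sum>i\<in>A. fps_X ^ card (cyclic_valleys (insert m A) (\<sigma> \<circ> transpose i m))) =
        of_nat (card A) * fps_X * fps_X ^ card (cyclic_valleys A \<sigma>) +
        2 * fps_X * (1 - fps_X) * fps_deriv ((fps_X :: rat fps) ^ card (cyclic_valleys A \<sigma>))"
      unfolding v_def[symmetric] d
      by (subst sum_insert_greatest_cyclic_valleys[OF \<sigma>(1) fin nofix m])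
        (simp_all add: algebra_simps v_def)
  qed simp
  also have "\<dots> = of_nat (card A) * fps_X * S + 2 * fps_X * (1 - fps_X) * fps_deriv S"
    by (simp add: S_def sum.distrib sum_distrib_left fps_deriv_sum)
  finally show ?thesis .
qed

section \<open>Cycle types\<close>

definition perms_with_cycle_type :: "'a set \<Rightarrow> nat multiset \<Rightarrow> ('a \<Rightarrow> 'a) set" where
  "perms_with_cycle_type A lam =
     {\<pi>. \<pi> permutes A \<and> image_mset card (mset_set (orbit \<pi> ` A)) = lam}"

section \<open>Product of a cycle and a permutation of a disjoint set\<close>

context
  fixes B C :: "'a set" and \<sigma> \<rho> :: "'a \<Rightarrow> 'a"
  assumes \<sigma>: "\<sigma> \<in> cyclic_perms B" and \<rho>: "\<rho> permutes C"
    and disj: "B \<inter> C = {}" and fin: "finite B" "finite C"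
begin

lemma cyclic_factor_permutes: "\<sigma> permutes B" and cyclic_factor_cyclic: "cyclic_on \<sigma> B"
  using \<sigma> by (auto simp: cyclic_perms_def)

lemma comp_permutes: "\<sigma> \<circ> \<rho> permutes B \<union> C"
  using permutes_subset[OF cyclic_factor_permutes, of "B \<union> C"] permutes_subset[OF \<rho>, of "B \<union> C"]
  by (auto intro: permutes_compose)

lemma comp_apply_cyclic: "x \<in> B \<Longrightarrow> (\<sigma> \<circ> \<rho>) x = \<sigma> x"
  using permutes_not_in[OF \<rho>, of x] disj by (metis comp_apply disjoint_iff)

lemma comp_apply_other: "x \<in> C \<Longrightarrow> (\<sigma> \<circ> \<rho>) x = \<rho> x"
  using permutes_in_image[OF \<rho>, of x] permutes_not_in[OF cyclic_factor_permutes, of "\<rho> x"] disj by auto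

lemma orbit_comp_cyclic:
  assumes "x \<in> B"
  shows "orbit (\<sigma> \<circ> \<rho>) x = B"
proof -
  have "orbit \<sigma> x = orbit (\<sigma> \<circ> \<rho>) x"
    by (rule orbit_cong0[of x B])
      (use assms cyclic_factor_permutes comp_apply_cyclic in \<open>auto simp: permutes_in_image\<close>)
  then show ?thesis using orbit_cyclic_eq3[OF cyclic_factor_cyclic assms] by simp
qed

lemma orbit_comp_other:
  assumes "x \<in> C"
  shows "orbit (\<sigma> \<circ> \<rho>) x = orbit \<rho> x"
proof -
  have "orbit \<rho> x = orbit (\<sigma> \<circ> \<rho>) x"
    by (rule orbit_cong0[of x C]) (use assms \<rho> comp_apply_other in \<open>auto simp: permutes_in_image\<close>)
  then show ?thesis by simp
qed

text \<open>\<open>B\<close> is a single orbit of the product and is not an orbit of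
  \<open>\<rho>\<close>, as those lie in the disjoint set \<open>C\<close>. So the set of orbits
  gains exactly one element, even if another orbit has the same size.\<close>

lemma cycle_type_comp:
  "image_mset card (mset_set (orbit (\<sigma> \<circ> \<rho>) ` (B \<union> C))) =
    add_mset (card B) (image_mset card (mset_set (orbit \<rho> ` C)))"
proof -
  have ne: "B \<noteq> {}" using cyclic_factor_cyclic by (auto simp: cyclic_on_def)
  have "orbit (\<sigma> \<circ> \<rho>) ` B = {B}"
    using ne by (auto simp: orbit_comp_cyclic cong: image_cong_simp)
  then have "orbit (\<sigma> \<circ> \<rho>) ` (B \<union> C) = insert B (orbit \<rho> ` C)"
    by (simp add: image_Un orbit_comp_other cong: image_cong_simp)
  moreover have "B \<notin> orbit \<rho> ` C"
    using permutes_orbit_subset[OF \<rho>] disj ne by blast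
  ultimately show ?thesis using fin by simp
qed

lemma perm_restrict_comp_cyclic: "perm_restrict (\<sigma> \<circ> \<rho>) B = \<sigma>"
proof
  show "perm_restrict (\<sigma> \<circ> \<rho>) B x = \<sigma> x" for x
    using comp_apply_cyclic permutes_not_in[OF cyclic_factor_permutes, of x]
    by (cases "x \<in> B") (simp_all add: perm_restrict_simps)
qed

lemma perm_restrict_comp_other: "perm_restrict (\<sigma> \<circ> \<rho>) C = \<rho>"
proof
  show "perm_restrict (\<sigma> \<circ> \<rho>) C x = \<rho> x" for x
    using comp_apply_other permutes_not_in[OF \<rho>, of x]
    by (cases "x \<in> C") (simp_all add: perm_restrict_simps)
qed

end

text \<open>Being a valley depends only on the two neighbours within the same cycle, and on each of
  the two sets the product and its inverse agree with the respective factor.\<close>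

lemma card_cyclic_valleys_comp:
  assumes \<sigma>: "\<sigma> \<in> cyclic_perms B" and \<rho>: "\<rho> permutes C"
    and disj: "B \<inter> C = {}" and fin: "finite B" "finite C"
  shows "card (cyclic_valleys (B \<union> C) (\<sigma> \<circ> \<rho>)) =
    card (cyclic_valleys B \<sigma>) + card (cyclic_valleys C \<rho>)"
proof -
  have p: "\<sigma> permutes B" using \<sigma> by (simp add: cyclic_perms_def)
  have inv: "inv (\<sigma> \<circ> \<rho>) x = inv \<rho> (inv \<sigma> x)" for x
    by (simp add: o_inv_distrib[OF permutes_bij[OF p] permutes_bij[OF \<rho>]])
  have 1: "inv (\<sigma> \<circ> \<rho>) x = inv \<sigma> x" if "x \<in> B" for x
  proof -
    have "inv \<sigma> x \<in> B" using that permutes_in_image[OF permutes_inv[OF p]] by blast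
    then show ?thesis
      unfolding inv using permutes_not_in[OF permutes_inv[OF \<rho>]] disj by blast
  qed
  have 2: "inv (\<sigma> \<circ> \<rho>) x = inv \<rho> x" if "x \<in> C" for x
  proof -
    have "x \<notin> B" using that disj by blast
    then show ?thesis
      unfolding inv using permutes_not_in[OF permutes_inv[OF p]] by simp
  qed
  have "cyclic_valleys (B \<union> C) (\<sigma> \<circ> \<rho>) = cyclic_valleys B \<sigma> \<union> cyclic_valleys C \<rho>"
    using 1 2 comp_apply_cyclic[OF assms] comp_apply_other[OF assms]
    unfolding cyclic_valleys_def by fastforce
  moreover have "cyclic_valleys B \<sigma> \<inter> cyclic_valleys C \<rho> = {}"
    using disj by (auto simp: cyclic_valleys_def)
  ultimately show ?thesis using fin by (simp add: card_Un_disjoint cyclic_valleys_def)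
qed

lemma perm_restrict_orbit_permutes:
  assumes "\<pi> permutes A" "finite A" "a \<in> A"
  shows "perm_restrict \<pi> (orbit \<pi> a) permutes orbit \<pi> a"
proof (rule bij_imp_permutes)
  have cyc: "cyclic_on \<pi> (orbit \<pi> a)" using assms by (intro cyclic_on_orbit)
  have "inj_on \<pi> (orbit \<pi> a)" using assms by (intro permutes_inj_on)
  moreover have "\<pi> ` orbit \<pi> a \<subseteq> orbit \<pi> a" by (auto intro: orbit.step)
  ultimately have "bij_betw \<pi> (orbit \<pi> a) (orbit \<pi> a)"
    using finite_cyclic_on[OF cyc] by (simp add: bij_betw_def endo_inj_surj)
  then show "bij_betw (perm_restrict \<pi> (orbit \<pi> a)) (orbit \<pi> a) (orbit \<pi> a)"
    by (rule bij_betw_cong[THEN iffD1, rotated]) (simp add: perm_restrict_simps)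
qed (simp add: perm_restrict_simps)

text \<open>Exactly one cycle passes through \<open>a\<close>. This anchor makes the decomposition
  unique; an arbitrary choice of a cycle would count a permutation once for each of its
  cycles.\<close>

lemma sum_perms_with_cycle_type_split:
  assumes fin: "finite A" and a: "a \<in> A"
  shows "(\<Sum>\<pi>\<in>perms_with_cycle_type A lam. h \<pi>) =
    (\<Sum>B\<in>{B. B \<subseteq> A \<and> a \<in> B \<and> card B \<in># lam}. \<Sum>\<sigma>\<in>cyclic_perms B.
      \<Sum>\<rho>\<in>perms_with_cycle_type (A - B) (lam - {#card B#}). h (\<sigma> \<circ> \<rho>))"
proof -
  let ?Bs = "{B. B \<subseteq> A \<and> a \<in> B \<and> card B \<in># lam}"
  let ?R = "\<lambda>B. perms_with_cycle_type (A - B) (lam - {#card B#})"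
  let ?S = "SIGMA B:?Bs. cyclic_perms B \<times> ?R B"
  have finR: "finite (?R B)" for B
    using fin by (intro finite_subset[OF _ finite_permutations[of "A - B"]])
      (auto simp: perms_with_cycle_type_def)
  have finB: "finite B" if "B \<subseteq> A" for B using that fin by (rule finite_subset)
  have "(\<Sum>\<pi>\<in>perms_with_cycle_type A lam. h \<pi>) = (\<Sum>(B, \<sigma>, \<rho>)\<in>?S. h (\<sigma> \<circ> \<rho>))"
  proof (rule sum.reindex_bij_witness[where
        i = "\<lambda>(B, \<sigma>, \<rho>). \<sigma> \<circ> \<rho>" and
        j = "\<lambda>\<pi>. (orbit \<pi> a, perm_restrict \<pi> (orbit \<pi> a), perm_restrict \<pi> (A - orbit \<pi> a))"])
    fix \<pi> assume "\<pi> \<in> perms_with_cycle_type A lam"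
    then have \<pi>: "\<pi> permutes A" and lam: "image_mset card (mset_set (orbit \<pi> ` A)) = lam"
      by (auto simp: perms_with_cycle_type_def)
    let ?B = "orbit \<pi> a"
    let ?\<sigma> = "perm_restrict \<pi> ?B" and ?\<rho> = "perm_restrict \<pi> (A - ?B)"
    have BA: "?B \<subseteq> A" using \<pi> a by (rule permutes_orbit_subset)
    have aB: "a \<in> ?B"
      using \<pi> fin by (intro permutation_self_in_orbit permutes_imp_permutation)
    have cyc: "cyclic_on \<pi> ?B" using \<pi> fin by (rule cyclic_on_orbit)
    have \<sigma>: "?\<sigma> \<in> cyclic_perms ?B"
      using perm_restrict_orbit_permutes[OF \<pi> fin a] cyc
      by (simp add: cyclic_perms_def cyclic_on_perm_restrict)
    have \<rho>: "?\<rho> permutes A - ?B" using \<pi> cyc by (rule perm_restrict_diff_cyclic)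
    have un: "?B \<union> (A - ?B) = A" using BA by blast
    have "(?\<sigma> \<circ> ?\<rho>) = perm_restrict \<pi> (?B \<union> (A - ?B))"
      using \<sigma> \<rho> by (intro perm_restrict_union) (auto simp: cyclic_perms_def)
    then have comp: "?\<sigma> \<circ> ?\<rho> = \<pi>" using \<pi> un by simp
    have "lam = add_mset (card ?B) (image_mset card (mset_set (orbit ?\<rho> ` (A - ?B))))"
      using cycle_type_comp[OF \<sigma> \<rho>] finB[OF BA] fin lam unfolding comp un by simp
    then have "card ?B \<in># lam"
      and "image_mset card (mset_set (orbit ?\<rho> ` (A - ?B))) = lam - {#card ?B#}"
      by simp_all
    then show "(?B, ?\<sigma>, ?\<rho>) \<in> ?S"
      using BA aB \<sigma> \<rho> by (simp add: perms_with_cycle_type_def)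
    show "(case (?B, ?\<sigma>, ?\<rho>) of (B, \<sigma>, \<rho>) \<Rightarrow> \<sigma> \<circ> \<rho>) = \<pi>" using comp by simp
    show "(case (?B, ?\<sigma>, ?\<rho>) of (B, \<sigma>, \<rho>) \<Rightarrow> h (\<sigma> \<circ> \<rho>)) = h \<pi>" using comp by simp
  next
    fix x assume x: "x \<in> ?S"
    obtain B \<sigma> \<rho> where xeq: "x = (B, \<sigma>, \<rho>)" by (cases x)
    have B: "B \<subseteq> A" "a \<in> B" "card B \<in># lam" and \<sigma>: "\<sigma> \<in> cyclic_perms B"
      and \<rho>: "\<rho> permutes A - B"
      and type: "image_mset card (mset_set (orbit \<rho> ` (A - B))) = lam - {#card B#}"
      using x xeq by (auto simp: perms_with_cycle_type_def)
    have disj: "B \<inter> (A - B) = {}" and un: "B \<union> (A - B) = A" using B by auto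
    note comp_facts = \<sigma> \<rho> disj finB[OF B(1)] finite_Diff[OF fin]
    have orb: "orbit (\<sigma> \<circ> \<rho>) a = B" using orbit_comp_cyclic[OF comp_facts B(2)] .
    show "(orbit (case x of (B, \<sigma>, \<rho>) \<Rightarrow> \<sigma> \<circ> \<rho>) a,
        perm_restrict (case x of (B, \<sigma>, \<rho>) \<Rightarrow> \<sigma> \<circ> \<rho>) (orbit (case x of (B, \<sigma>, \<rho>) \<Rightarrow> \<sigma> \<circ> \<rho>) a),
        perm_restrict (case x of (B, \<sigma>, \<rho>) \<Rightarrow> \<sigma> \<circ> \<rho>)
          (A - orbit (case x of (B, \<sigma>, \<rho>) \<Rightarrow> \<sigma> \<circ> \<rho>) a)) = x"
      unfolding xeq prod.case orb
      using perm_restrict_comp_cyclic[OF comp_facts] perm_restrict_comp_other[OF comp_facts] by simp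
    show "(case x of (B, \<sigma>, \<rho>) \<Rightarrow> \<sigma> \<circ> \<rho>) \<in> perms_with_cycle_type A lam"
      unfolding xeq prod.case perms_with_cycle_type_def
      using comp_permutes[OF comp_facts] cycle_type_comp[OF comp_facts] B(3) type
      unfolding un by simp
  qed
  also have "\<dots> = (\<Sum>B\<in>?Bs. \<Sum>(\<sigma>, \<rho>)\<in>cyclic_perms B \<times> ?R B. h (\<sigma> \<circ> \<rho>))"
    using fin finB finR
    by (subst sum.Sigma) (auto intro!: finite_cartesian_product finite_cyclic_perms)
  finally show ?thesis by (simp add: sum.cartesian_product)
qed

section \<open>The numbers z and the recursion over cycle types\<close>

lemma z_part_add_mset: "z_part (add_mset i mu) = i * Suc (count mu i) * z_part mu"
proof -
  let ?f = "\<lambda>lam j. j ^ count lam j * fact (count lam j)"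
  \<comment> \<open>The factor at \<open>i\<close> may be isolated even if \<open>i\<close> is not a
    part, since it is then \<open>i ^ 0 * fact 0\<close>, that is 1.\<close>
  have z: "z_part lam = ?f lam i * prod (?f lam) (set_mset lam - {i})" for lam
  proof (cases "i \<in># lam")
    case True
    then show ?thesis by (simp add: z_part_def prod.remove)
  next
    case False
    then show ?thesis by (simp add: z_part_def not_in_iff)
  qed
  have "prod (?f (add_mset i mu)) (set_mset (add_mset i mu) - {i}) = prod (?f mu) (set_mset mu - {i})"
    by (rule prod.cong) auto
  then show ?thesis unfolding z[of mu] z[of "add_mset i mu"] by (simp add: algebra_simps)
qed

lemma z_part_pos: "0 \<notin># lam \<Longrightarrow> z_part lam > 0"
  by (auto simp: z_part_def intro!: prod_pos intro: gr0I)

lemma card_subsets_containing: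
  assumes "finite A" "a \<in> A" "i > 0"
  shows "card {B. B \<subseteq> A \<and> a \<in> B \<and> card B = i} = (card A - 1) choose (i - 1)"
proof -
  have "bij_betw (insert a) {B. B \<subseteq> A - {a} \<and> card B = i - 1} {B. B \<subseteq> A \<and> a \<in> B \<and> card B = i}"
  proof (rule bij_betw_byWitness[where f' = "\<lambda>B. B - {a}"])
    show "insert a ` {B. B \<subseteq> A - {a} \<and> card B = i - 1} \<subseteq> {B. B \<subseteq> A \<and> a \<in> B \<and> card B = i}"
    proof safe
      fix B assume "B \<subseteq> A - {a}" "card B = i - 1"
      moreover from this have "finite B" "a \<notin> B" using assms(1) by (auto intro: finite_subset)
      ultimately show "card (insert a B) = i" using assms(3) by simp
    qed (use assms in auto)
  qed (use assms in \<open>auto intro: finite_subset\<close>)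
  then have "card {B. B \<subseteq> A \<and> a \<in> B \<and> card B = i} = card {B. B \<subseteq> A - {a} \<and> card B = i - 1}"
    by (simp add: bij_betw_same_card)
  then show ?thesis using assms by (simp add: n_subsets)
qed

lemma sum_mset_conv_sum_count: "sum_mset M = (\<Sum>i\<in>set_mset M. count M i * i)" for M :: "nat multiset"
proof (induction M)
  case (add x M)
  have "(\<Sum>i\<in>set_mset (add_mset x M). count (add_mset x M) i * i) =
      (\<Sum>i\<in>insert x (set_mset M). (if i = x then x else 0) + count M i * i)"
    by (intro sum.cong) auto
  also have "\<dots> = x + (\<Sum>i\<in>insert x (set_mset M). count M i * i)"
    unfolding sum.distrib by (subst sum.delta) simp_all
  also have "(\<Sum>i\<in>insert x (set_mset M). count M i * i) = (\<Sum>i\<in>set_mset M. count M i * i)"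
    by (intro sum.mono_neutral_right) (auto simp: not_in_iff)
  finally show ?case using add.IH by simp
qed simp

text \<open>
  Splitting off the cycle through a fixed element \<open>a\<close> of \<open>A\<close> reduces the claim to
  \<open>\<Sum>\<^sub>i i m\<^sub>i = n\<close>.
\<close>

lemma sum_cyclic_valleys_perms_with_cycle_type:
  fixes c :: "nat \<Rightarrow> rat fps" and A :: "nat set"
  assumes c: "\<And>B :: nat set. finite B \<Longrightarrow> B \<noteq> {} \<Longrightarrow>
      (\<Sum>\<sigma>\<in>cyclic_perms B. fps_X ^ card (cyclic_valleys B \<sigma>)) = c (card B)"
    and "finite A" "0 \<notin># lam" "sum_mset lam = card A"
  shows "(\<Sum>\<pi>\<in>perms_with_cycle_type A lam. fps_X ^ card (cyclic_valleys A \<pi>)) =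
    fps_const (fact (card A) / of_nat (z_part lam)) *
      (\<Prod>i\<in>#lam. c i * fps_const (1 / fact (i - 1)))"
  using assms(2-)
proof (induction A arbitrary: lam rule: finite_psubset_induct)
  case (psubset A)
  show ?case
  proof (cases "A = {}")
    case True
    then have "lam = {#}" using psubset.prems by (cases lam) auto
    with True show ?thesis
      by (simp add: perms_with_cycle_type_def cyclic_valleys_def z_part_def)
  next
    case False
    then obtain a where a: "a \<in> A" by blast
    define n where "n = card A"
    have n: "n > 0" using False psubset.hyps by (simp add: n_def card_gt_0_iff)
    let ?Bs = "{B. B \<subseteq> A \<and> a \<in> B \<and> card B \<in># lam}"
    define d where "d i = c i * fps_const (1 / fact (i - 1))" for i
    define P where "P mu = (\<Prod>i\<in>#mu. d i)" for mu
    \<comment> \<open>The contribution of one cycle set of size \<open>i\<close> through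
      \<open>a\<close>: its own enumerator times the claimed formula for the remaining points. It
      depends only on the size, so the cycle sets can be grouped by size.\<close>
    define g where "g i = c i * (fps_const (fact (n - i) / of_nat (z_part (lam - {#i#}))) * P (lam - {#i#}))" for i
    have finBs: "finite ?Bs" using psubset.hyps by simp
    have "(\<Sum>\<pi>\<in>perms_with_cycle_type A lam. (fps_X :: rat fps) ^ card (cyclic_valleys A \<pi>)) =
        (\<Sum>B\<in>?Bs. \<Sum>\<sigma>\<in>cyclic_perms B. \<Sum>\<rho>\<in>perms_with_cycle_type (A - B) (lam - {#card B#}).
          fps_X ^ card (cyclic_valleys A (\<sigma> \<circ> \<rho>)))"
      using psubset.hyps a by (rule sum_perms_with_cycle_type_split)
    also have "\<dots> = (\<Sum>B\<in>?Bs. g (card B))"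
    proof (rule sum.cong)
      fix B assume B: "B \<in> ?Bs"
      then have BA: "B \<subseteq> A" and aB: "a \<in> B" and mem: "card B \<in># lam" by auto
      have finB: "finite B" using BA psubset.hyps by (rule finite_subset)
      have un: "B \<union> (A - B) = A" using BA by blast
      have lam: "lam = add_mset (card B) (lam - {#card B#})" using mem by simp
      have "card (A - B) = card A - card B" using finB BA by (rule card_Diff_subset)
      moreover have "sum_mset lam = card B + sum_mset (lam - {#card B#})"
        by (subst lam) simp
      ultimately have sum: "sum_mset (lam - {#card B#}) = card (A - B)"
        using psubset.prems by simp
      have "(\<Sum>\<sigma>\<in>cyclic_perms B. \<Sum>\<rho>\<in>perms_with_cycle_type (A - B) (lam - {#card B#}).
          (fps_X :: rat fps) ^ card (cyclic_valleys A (\<sigma> \<circ> \<rho>))) =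
        (\<Sum>\<sigma>\<in>cyclic_perms B. \<Sum>\<rho>\<in>perms_with_cycle_type (A - B) (lam - {#card B#}).
          fps_X ^ card (cyclic_valleys B \<sigma>) * fps_X ^ card (cyclic_valleys (A - B) \<rho>))"
      proof (intro sum.cong refl)
        fix \<sigma> \<rho>
        assume "\<sigma> \<in> cyclic_perms B" "\<rho> \<in> perms_with_cycle_type (A - B) (lam - {#card B#})"
        then have "card (cyclic_valleys (B \<union> (A - B)) (\<sigma> \<circ> \<rho>)) =
            card (cyclic_valleys B \<sigma>) + card (cyclic_valleys (A - B) \<rho>)"
          using finB psubset.hyps
          by (intro card_cyclic_valleys_comp) (auto simp: perms_with_cycle_type_def)
        then show "(fps_X :: rat fps) ^ card (cyclic_valleys A (\<sigma> \<circ> \<rho>)) =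
            fps_X ^ card (cyclic_valleys B \<sigma>) * fps_X ^ card (cyclic_valleys (A - B) \<rho>)"
          by (simp only: un power_add)
      qed
      also have "\<dots> = (\<Sum>\<sigma>\<in>cyclic_perms B. fps_X ^ card (cyclic_valleys B \<sigma>)) *
          (\<Sum>\<rho>\<in>perms_with_cycle_type (A - B) (lam - {#card B#}).
            fps_X ^ card (cyclic_valleys (A - B) \<rho>))"
        by (simp add: sum_product)
      also have "(\<Sum>\<sigma>\<in>cyclic_perms B. fps_X ^ card (cyclic_valleys B \<sigma>)) = c (card B)"
        using finB aB by (intro c) auto
      also have "(\<Sum>\<rho>\<in>perms_with_cycle_type (A - B) (lam - {#card B#}).
            fps_X ^ card (cyclic_valleys (A - B) \<rho>)) =
          fps_const (fact (n - card B) / of_nat (z_part (lam - {#card B#}))) * P (lam - {#card B#})"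
        unfolding P_def d_def n_def using psubset.IH[of "A - B" "lam - {#card B#}"] BA aB
          psubset.prems(1) sum \<open>card (A - B) = card A - card B\<close>
        by (auto dest: in_diffD)
      finally show "(\<Sum>\<sigma>\<in>cyclic_perms B.
          \<Sum>\<rho>\<in>perms_with_cycle_type (A - B) (lam - {#card B#}).
            (fps_X :: rat fps) ^ card (cyclic_valleys A (\<sigma> \<circ> \<rho>))) = g (card B)"
        by (simp only: g_def)
    qed simp
    also have "\<dots> = (\<Sum>i\<in>set_mset lam. \<Sum>B\<in>{B \<in> ?Bs. card B = i}. g (card B))"
      using finBs by (intro sum.group[symmetric]) auto
    also have "\<dots> = (\<Sum>i\<in>set_mset lam.
        fps_const (fact (n - 1) / of_nat (z_part lam)) * P lam * of_nat (count lam i * i))"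
    proof (rule sum.cong)
      fix i assume i: "i \<in># lam"
      then have "i > 0" using psubset.prems by (auto intro: gr0I)
      obtain mu where mu: "lam = add_mset i mu" using i by (metis multi_member_split)
      have "i \<le> n" using psubset.prems mu by (simp add: n_def)
      have "{B \<in> ?Bs. card B = i} = {B. B \<subseteq> A \<and> a \<in> B \<and> card B = i}" using i by auto
      then have "card {B \<in> ?Bs. card B = i} = (n - 1) choose (i - 1)"
        using psubset.hyps a \<open>i > 0\<close> by (simp add: card_subsets_containing n_def)
      then have "(\<Sum>B\<in>{B \<in> ?Bs. card B = i}. g (card B)) = of_nat ((n - 1) choose (i - 1)) * g i"
        by simp
      also have "\<dots> = fps_const (of_nat ((n - 1) choose (i - 1)) *
          (fact (n - i) / of_nat (z_part mu))) * (c i * P mu)"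
        by (simp add: g_def mu fps_of_nat[symmetric] mult_ac flip: fps_const_mult)
      \<comment> \<open>Since z of \<open>lam\<close> is i m_i times z of \<open>mu\<close>,
        removing the part costs a factor i m_i, while the binomial leaves the 1 / (i - 1)! that
        \<open>d i\<close> carries. Apart from i m_i, the result no longer depends on
        \<open>i\<close>.\<close>
      also have "of_nat ((n - 1) choose (i - 1)) * (fact (n - i) / of_nat (z_part mu)) =
          (fact (n - 1) / of_nat (z_part lam) * of_nat (count lam i * i) * (1 / fact (i - 1)) :: rat)"
      proof -
        define q z :: rat where "q = of_nat (count lam i * i)" and "z = of_nat (z_part mu)"
        have "z_part mu > 0" using psubset.prems mu by (intro z_part_pos) auto
        then have "z \<noteq> 0" by (simp add: z_def)
        moreover have "q \<noteq> 0" using \<open>i > 0\<close> mu by (simp add: q_def del: of_nat_mult)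
        moreover have "of_nat (z_part lam) = q * z"
          by (simp add: mu z_part_add_mset q_def z_def mult_ac)
        moreover have "n - 1 - (i - 1) = n - i" using \<open>i > 0\<close> by simp
        then have "of_nat ((n - 1) choose (i - 1)) = (fact (n - 1) / (fact (i - 1) * fact (n - i)) :: rat)"
          using \<open>i \<le> n\<close> by (subst binomial_fact) auto
        ultimately show ?thesis
          unfolding q_def[symmetric] z_def[symmetric] by simp
      qed
      also have "fps_const (fact (n - 1) / of_nat (z_part lam) * of_nat (count lam i * i) *
          (1 / fact (i - 1))) * (c i * P mu) =
          fps_const (fact (n - 1) / of_nat (z_part lam)) * P lam * of_nat (count lam i * i)"
        by (simp add: mu P_def d_def fps_of_nat[symmetric] mult_ac flip: fps_const_mult del: of_nat_Suc of_nat_mult)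
      finally show "(\<Sum>B\<in>{B \<in> ?Bs. card B = i}. g (card B)) =
          fps_const (fact (n - 1) / of_nat (z_part lam)) * P lam * of_nat (count lam i * i)" .
    qed simp
    also have "\<dots> = fps_const (fact (n - 1) / of_nat (z_part lam)) * P lam *
        of_nat (\<Sum>i\<in>set_mset lam. count lam i * i)"
      by (simp only: sum_distrib_left of_nat_sum)
    also have "(\<Sum>i\<in>set_mset lam. count lam i * i) = n"
      using psubset.prems by (simp add: n_def sum_mset_conv_sum_count)
    also have "fps_const (fact (n - 1) / of_nat (z_part lam)) * P lam * of_nat n =
        fps_const (fact n / of_nat (z_part lam)) * P lam"
      using n by (cases n) (simp_all add: fps_of_nat[symmetric] mult_ac flip: fps_const_mult del: of_nat_Suc)
    finally show ?thesis by (simp add: P_def d_def n_def)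
  qed
qed

section \<open>Substituting the power series\<close>

text \<open>With t = (1 - s) (1 + s), the factor 1 - s cancels from t (w + 1) = 2 (1 - s). It has
  zero constant term and is no unit, so the cancellation rests on the absence of zero
  divisors.\<close>

lemma w_fps_mult: "(1 + sqrt_one_minus_X) * w_fps = 1 - sqrt_one_minus_X"
proof -
  let ?s = sqrt_one_minus_X
  have X: "fps_X = (1 - ?s) * (1 + ?s)"
    using sqrt_one_minus_X_power2 by (simp add: algebra_simps power2_eq_square)
  have "1 - ?s \<noteq> 0" using X by auto
  moreover have "(1 - ?s) * ((1 + ?s) * (w_fps + 1)) = (1 - ?s) * 2"
    using fps_X_times_w_fps unfolding X by (simp add: mult_ac)
  ultimately have "(1 + ?s) * (w_fps + 1) = 2" by (simp only: mult_cancel_left) simp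
  then show ?thesis by (simp add: algebra_simps eq_diff_eq)
qed

lemma fps_deriv_sqrt_one_minus_X: "2 * sqrt_one_minus_X * fps_deriv sqrt_one_minus_X = - 1"
proof -
  have "fps_deriv (sqrt_one_minus_X ^ 2) = - 1"
    unfolding sqrt_one_minus_X_power2 by simp
  then show ?thesis by (simp add: power2_eq_square mult_ac)
qed

text \<open>The quotient rule for (1 - s) / (1 + s), cleared of denominators; the numerator
  collapses because (1 + s) + (1 + s) w = 2.\<close>

lemma fps_deriv_w_fps: "(1 + sqrt_one_minus_X) ^ 2 * fps_deriv w_fps = - 2 * fps_deriv sqrt_one_minus_X"
proof -
  let ?s = sqrt_one_minus_X
  have "fps_deriv ((1 + ?s) * w_fps) = fps_deriv (1 - ?s)" by (simp only: w_fps_mult)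
  then have "(1 + ?s) * fps_deriv w_fps = - fps_deriv ?s * (1 + w_fps)"
    by (simp add: algebra_simps eq_neg_iff_add_eq_0)
  then have "(1 + ?s) ^ 2 * fps_deriv w_fps = (1 + ?s) * (- fps_deriv ?s * (1 + w_fps))"
    by (simp only: power2_eq_square mult.assoc)
  also have "\<dots> = - fps_deriv ?s * ((1 + ?s) + (1 + ?s) * w_fps)"
    by (simp add: algebra_simps)
  finally show ?thesis by (simp add: w_fps_mult)
qed

text \<open>The chain rule needs the coefficients of the polynomial to be constant power series.\<close>

lemma fps_deriv_poly_eulerian_poly:
  "fps_deriv (poly (eulerian_poly n) f) = poly (pderiv (eulerian_poly n)) f * fps_deriv f"
  for f :: "'a :: idom fps"
proof (cases "n = 0")
  case False
  have "pderiv (\<Sum>\<pi> | \<pi> permutes {1..n}. monom (1 :: 'a fps) (des n \<pi> + 1)) =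
      (\<Sum>\<pi> | \<pi> permutes {1..n}. pderiv (monom 1 (des n \<pi> + 1)))"
    by (rule higher_pderiv_sum[of 1, simplified])
  with False show ?thesis
    by (simp add: eulerian_poly_def poly_sum poly_monom pderiv_monom fps_deriv_sum fps_deriv_power'
        sum_distrib_left mult_ac del: power_Suc of_nat_Suc)
qed (simp add: eulerian_poly_def pderiv_1)

text \<open>After eliminating w, w' and s', both sides are linear in the values \<open>P\<close> of
  the polynomial and \<open>D\<close> of its derivative, and the coefficients agree as polynomials
  in s.\<close>

lemma eulerian_substitution:
  fixes k :: nat
  assumes "k > 0"
  defines "F \<equiv> \<lambda>k. (1 + sqrt_one_minus_X) ^ Suc k * poly (eulerian_poly k) w_fps"
  shows "F (Suc k) = of_nat (Suc k) * fps_X * F k + 2 * fps_X * (1 - fps_X) * fps_deriv (F k)"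
proof -
  define s where "s = sqrt_one_minus_X"
  define w where "w = w_fps"
  define P D where "P = poly (eulerian_poly k) w" and "D = poly (pderiv (eulerian_poly k)) w"
  define s' w' where "s' = fps_deriv s" and "w' = fps_deriv w"
  define K :: "rat fps" where "K = of_nat (Suc k)"
  \<comment> \<open>The power common to all terms: w' absorbs two of the k + 1 factors 1 + s. As k
    is positive, the exponent does not truncate.\<close>
  define c where "c = (1 + s) ^ (k - 1)"
  have s': "2 * s * s' = - 1" using fps_deriv_sqrt_one_minus_X by (simp add: s_def s'_def)
  have w: "(1 + s) * w = 1 - s" using w_fps_mult by (simp add: s_def w_def)
  have w': "(1 + s)\<^sup>2 * w' = - 2 * s'" using fps_deriv_w_fps by (simp add: s_def w_def s'_def w'_def)
  have X: "fps_X = 1 - s\<^sup>2" using sqrt_one_minus_X_power2 by (simp add: s_def)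
  have pow: "(1 + s) ^ k = (1 + s) * c" using assms(1) by (cases k) (simp_all add: c_def)
  have "poly (eulerian_poly (Suc k)) w = K * w * P + w * (1 - w) * D"
    unfolding eulerian_poly_Suc[OF assms(1)] by (simp add: P_def D_def K_def poly_monom del: of_nat_Suc)
  then have L: "F (Suc k) = (1 + s) * (1 + s) * (1 + s) * c * (K * w * P + w * (1 - w) * D)"
    by (simp add: F_def s_def[symmetric] w_def[symmetric] pow mult_ac)
  have "fps_deriv (F k) = K * s' * (1 + s) ^ k * P + (1 + s) ^ Suc k * (D * w')"
    unfolding F_def fps_deriv_mult fps_deriv_poly_eulerian_poly
    by (simp add: fps_deriv_power' s_def[symmetric] w_def[symmetric] P_def D_def K_def s'_def w'_def mult_ac
        del: of_nat_Suc power_Suc)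
  then have R: "of_nat (Suc k) * fps_X * F k + 2 * fps_X * (1 - fps_X) * fps_deriv (F k) =
      K * fps_X * ((1 + s) * (1 + s) * c * P) +
      2 * fps_X * (1 - fps_X) * (K * s' * ((1 + s) * c) * P + c * D * ((1 + s)\<^sup>2 * w'))"
    by (simp add: F_def s_def[symmetric] w_def[symmetric] P_def K_def pow power2_eq_square mult_ac
        del: of_nat_Suc)
  \<comment> \<open>Here 1 - t = s^2 compensates the denominator of s' = - 1 / (2 s).\<close>
  have "2 * fps_X * (1 - fps_X) * s' = - fps_X * s"
  proof -
    have "2 * fps_X * (1 - fps_X) * s' = fps_X * s * (2 * s * s')"
      by (simp add: X power2_eq_square mult_ac)
    then show ?thesis by (simp add: s')
  qed
  note T = this
  have R': "2 * fps_X * (1 - fps_X) * (K * s' * ((1 + s) * c) * P + c * D * ((1 + s)\<^sup>2 * w')) =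
      - fps_X * s * (K * (1 + s) * c * P - 2 * c * D)"
  proof -
    have "t * (K * s' * ((1 + s) * c) * P + c * D * (- 2 * s')) =
        (t * s') * (K * (1 + s) * c * P - 2 * c * D)" for t
      by (simp add: algebra_simps)
    then show ?thesis by (simp only: w' T)
  qed
  have "F (Suc k) = c * (1 + s) * (1 + s) * ((1 + s) * w) * K * P +
      c * (1 + s) * ((1 + s) * w) * ((1 + s) - (1 + s) * w) * D"
    unfolding L by (simp add: algebra_simps)
  also have "\<dots> = c * (1 + s) * (1 + s) * (1 - s) * K * P + c * (1 + s) * (1 - s) * (2 * s) * D"
    unfolding w by simp
  also have "\<dots> = K * fps_X * ((1 + s) * (1 + s) * c * P) - fps_X * s * (K * (1 + s) * c * P - 2 * c * D)"
    unfolding X by (simp add: algebra_simps power2_eq_square)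
  finally show ?thesis unfolding R R' by simp
qed

section \<open>Closed form for cyclic permutations\<close>

lemma sum_cyclic_valleys_cyclic_perms:
  fixes A :: "nat set"
  assumes "finite A" "card A = Suc k" "k > 0"
  shows "(\<Sum>\<sigma>\<in>cyclic_perms A. fps_X ^ card (cyclic_valleys A \<sigma>)) =
    (1 + sqrt_one_minus_X) ^ Suc k * poly (eulerian_poly k) w_fps"
  using assms(3,1,2)
proof (induction k arbitrary: A rule: nat_induct_non_zero)
  case 1
  then obtain a b where ab: "A = {a, b}" "a \<noteq> b" by (auto simp: card_2_iff numeral_2_eq_2[symmetric])
  define x m where "x = min a b" and "m = max a b"
  have A: "A = insert m {x}" and "x < m" using ab by (auto simp: x_def m_def)
  have "(\<Sum>\<sigma>\<in>cyclic_perms A. (fps_X :: rat fps) ^ card (cyclic_valleys A \<sigma>)) =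
      fps_X ^ card (cyclic_valleys (insert m {x}) (transpose x m))"
    unfolding A using \<open>x < m\<close> by (subst sum_cyclic_perms_insert) (simp_all add: cyclic_perms_singleton)
  also have "cyclic_valleys (insert m {x}) (transpose x m) = {x}"
    using \<open>x < m\<close> by (auto simp: cyclic_valleys_def)
  \<comment> \<open>The smaller element of a 2-cycle is its only valley, and t = (1 + s) (1 - s) =
    (1 + s)^2 w, which fits A_1 = x.\<close>
  also have "fps_X ^ card {x} = (1 + sqrt_one_minus_X) * ((1 + sqrt_one_minus_X) * w_fps)"
    unfolding w_fps_mult using sqrt_one_minus_X_power2 by (simp add: algebra_simps power2_eq_square)
  finally show ?case by (simp add: eulerian_poly_1 poly_monom mult_ac)
next
  case (Suc k)
  define m where "m = Max A"
  define A' where "A' = A - {m}"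
  have "A \<noteq> {}" using Suc.prems by auto
  then have "m \<in> A" using Suc.prems by (simp add: m_def)
  then have A: "A = insert m A'" by (auto simp: A'_def)
  have A': "finite A'" "card A' = Suc k" using Suc.prems \<open>m \<in> A\<close> by (simp_all add: A'_def)
  have lt: "x < m" if "x \<in> A'" for x
    using that Suc.prems by (simp add: A'_def m_def order.not_eq_order_implies_strict)
  have "card A' \<ge> 2" using A' Suc.hyps by simp
  from sum_cyclic_valleys_insert[OF A'(1) this lt] show ?case
    unfolding A Suc.IH[OF A'] A'(2) eulerian_substitution[OF Suc.hyps] .
qed

theorem theorem13:
  fixes n :: nat and lam :: "nat multiset"
  assumes "n > 0"
    and "0 \<notin># lam" and "sum_mset lam = n"
  shows "(\<Sum>\<pi>\<in>perms_of_type n lam. (fps_X :: rat fps) ^ cval n \<pi>) =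
    fps_const (fact n / of_nat (z_part lam)) *
      (1 + sqrt_one_minus_X) ^ (n - count lam 1) *
      (\<Prod>i\<in>set_mset lam.
        (poly (eulerian_poly (i - 1)) w_fps / fact (i - 1)) ^ count lam i)"
proof -
  \<comment> \<open>Exponent 0 for a fixed point yields \<open>c 1 = 1\<close>, the enumerator of
    the one-element cycle. Over all parts these exponents add up to n - m_1.\<close>
  define e where "e i = (if i = 1 then 0 else i)" for i :: nat
  define c where "c i = (1 + sqrt_one_minus_X) ^ e i * poly (eulerian_poly (i - 1)) w_fps" for i
  have c: "(\<Sum>\<sigma>\<in>cyclic_perms B. fps_X ^ card (cyclic_valleys B \<sigma>)) = c (card B)"
    if B: "finite B" "B \<noteq> {}" for B :: "nat set"
  proof (cases "card B = 1")
    case True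
    then obtain a where "B = {a}" by (auto simp: card_1_singleton_iff)
    then show ?thesis
      by (simp add: cyclic_perms_singleton cyclic_valleys_def c_def e_def eulerian_poly_def)
  next
    case False
    moreover have "card B > 0" using B by (simp add: card_gt_0_iff)
    ultimately obtain k where k: "card B = Suc k" "k > 0"
      by (metis One_nat_def gr0_conv_Suc neq0_conv)
    then show ?thesis
      using sum_cyclic_valleys_cyclic_perms[OF B(1) k] by (simp add: c_def e_def)
  qed
  have fact_div: "f * fps_const (1 / fact j) = f / fact j" for f :: "rat fps" and j
  proof -
    have "fact j = fps_const (fact j :: rat)" by (metis fps_of_nat of_nat_fact)
    then show ?thesis by (simp add: fps_divide_unit fps_const_inverse inverse_eq_divide)
  qed
  have "(\<Sum>i\<in>set_mset lam. e i * count lam i) = n - count lam 1"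
  proof -
    \<comment> \<open>Fixed points are added back, so that the subtraction of natural numbers
      happens only at the end.\<close>
    have "n = (\<Sum>i\<in>set_mset lam. e i * count lam i + (if i = 1 then count lam 1 else 0))"
      using assms(3) unfolding sum_mset_conv_sum_count by (auto simp: e_def intro!: sum.cong)
    also have "\<dots> = (\<Sum>i\<in>set_mset lam. e i * count lam i) + count lam 1"
      by (simp add: sum.distrib sum.delta not_in_iff)
    finally show ?thesis by simp
  qed
  then have exponent: "(\<Prod>i\<in>set_mset lam. ((1 + sqrt_one_minus_X) ^ e i) ^ count lam i) =
      (1 + sqrt_one_minus_X) ^ (n - count lam 1)"
    by (simp add: power_mult[symmetric] power_sum[symmetric])
  have "(\<Sum>\<pi>\<in>perms_of_type n lam. (fps_X :: rat fps) ^ cval n \<pi>) =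
      (\<Sum>\<pi>\<in>perms_with_cycle_type {1..n} lam. fps_X ^ card (cyclic_valleys {1..n} \<pi>))"
    by (simp add: perms_of_type_def perms_with_cycle_type_def cycle_type_def cval_def cyclic_valleys_def)
  also have "\<dots> = fps_const (fact n / of_nat (z_part lam)) *
      (\<Prod>i\<in>#lam. c i * fps_const (1 / fact (i - 1)))"
    using sum_cyclic_valleys_perms_with_cycle_type[OF c, of "{1..n}" lam] assms by simp
  also have "(\<Prod>i\<in>#lam. c i * fps_const (1 / fact (i - 1))) =
      (\<Prod>i\<in>set_mset lam. ((1 + sqrt_one_minus_X) ^ e i) ^ count lam i *
        (poly (eulerian_poly (i - 1)) w_fps / fact (i - 1)) ^ count lam i)"
    unfolding image_prod_mset_multiplicity
    by (simp only: c_def mult.assoc fact_div[symmetric] power_mult_distrib)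
  finally show ?thesis
    by (simp only: prod.distrib exponent mult.assoc)
qed

end
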